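(* The total latency at a Best-case Nash Equilibrium can be arbitrarily worse than at a Best-case Altruistic Nash Equilibrium, even when autonomous users have arbitrarily low altruism. That is, for every $M>0$ and every $\varepsilon>0$ there exist a network of parallel roads, a flow demand $(\bar{x},\bar{y})$, and a uniform altruism level $\kappa_0\in(1,1+\varepsilon)$ such that $$\frac{C^{\mathrm{BNE}}}{C^{\mathrm{BANE}}}\ge M,$$ where $C^{\mathrm{BNE}}$ is the total latency of a Best-case Nash Equilibrium (all vehicles selfish) and $C^{\mathrm{BANE}}$ is the total latency of a Best-case Altruistic Nash Equilibrium when all autonomous users are $\kappa_0$-altruistic.
   Context: Network model. There are $N$ parallel roads (same origin and destination), indexed by $[N]=\{1,\dots,N\}$. Road $i$ has length $d_i>0$, free-flow speed $v^f_i>0$, maximum density $\rho^{\max}_i$, and nominal headways $\bar{h}_i\le h_i$ for autonomous and human-driven vehicles respectively; all vehicles have length $L>0$. Let $x_i,y_i\ge 0$ be the human-driven and autonomous flow on road $i$. The critical density is $$\rho^{\mathrm{crit}}_i(x_i,y_i)=\left(\frac{y_i}{x_i+y_i}\bar{h}_i+\frac{x_i}{x_i+y_i}h_i+L\right)^{-1},$$ with $\rho^{\mathrm{crit}}_i<\rho^{\max}_i$ always, and the maximum flow is $z^{\max}_i(x_i,y_i)=v^f_i\,\rho^{\mathrm{crit}}_i(x_i,y_i)$. The state $s_i\in\{0,1\}$ says whether road $i$ is in free-flow ($s_i=0$) or congested ($s_i=1$). The latency is $$\ell_i(x_i,y_i,s_i)=\begin{cases} d_i/v^f_i, & s_i=0,\\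 d_i\left(\dfrac{\rho^{\max}_i}{x_i+y_i}+\dfrac{\rho^{\mathrm{crit}}_i(x_i,y_i)-\rho^{\max}_i}{z^{\max}_i(x_i,y_i)}\right), & s_i=1.\end{cases}$$ The free-flow latency is $a_i=d_i/v^f_i$; no two roads have equal free-flow latencies and roads are ordered so that $a_1<a_2<\dots<a_N$. A road with zero flow is in free-flow (latency $a_i$). Routings. The demand $(\bar{x},\bar{y})$, $\bar{x},\bar{y}\ge 0$, is inelastic. A feasible routing of the demand is a triple $(\boldsymbol{x},\boldsymbol{y},\boldsymbol{s})\in\mathbb{R}^N_{\ge0}\times\mathbb{R}^N_{\ge0}\times\{0,1\}^N$ with $\sum_i x_i=\bar{x}$, $\sum_i y_i=\bar{y}$ and $x_i+y_i\le z^{\max}_i(x_i,y_i)$ on every road (trivially satisfied if $x_i+y_i=0$). Its total latency is $C(\boldsymbol{x},\boldsymbol{y},\boldsymbol{s})=\sum_{i\in[N]}(x_i+y_i)\ell_i(x_i,y_i,s_i)$. Nash equilibrium. A feasible routing is a Nash Equilibrium if $x_i+y_i>0$ implies $\ell_i(x_i,y_i,s_i)\le \ell_j(x_j,y_j,s_j)$ for all $j\in[N]$. A Best-case Nash Equilibrium (BNE) is a Nash Equilibrium minimizing $C$ among all Nash Equilibria for the demand. Altruistic equilibrium. Human drivers are selfish. Autonomous users are (uniformly) $\kappa_0$-altruistic if their altruism profile is $\varphi(\kappa)=0$ for $0\le\kappa\le\kappa_0$ and $\varphi(\kappa)=1$ for $\kappa>\kappa_0$. A feasible routing is an Altruistic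 Nash Equilibrium with equilibrium latency $\hat{\ell}_0$ and profile $\varphi$ if (i) all roads with human-driven flow have latency $\hat{\ell}_0$, and $\hat{\ell}_0\le\ell_i(x_i,y_i,s_i)$ for all $i\in[N]$; and (ii) for every $\ell\ge0$, a volume of at least $\varphi(\ell/\hat{\ell}_0)\,\bar{y}$ of autonomous traffic experiences a delay less than or equal to $\ell$. A Best-case Altruistic Nash Equilibrium (BANE) is an Altruistic Nash Equilibrium (over all $\hat{\ell}_0$) minimizing $C$. *)

theory Defs
  imports Complex_Main
begin

text \<open>
  Parallel-road networks with mixed traffic. Roads are indexed by \<open>{1..num_roads}\<close>; the values of
  all road-indexed functions outside this range are irrelevant.
\<close>

record road_network =
  num_roads :: nat
  veh_len :: real
  road_len :: "nat \<Rightarrow> real"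
  ff_speed :: "nat \<Rightarrow> real"
  max_dens :: "nat \<Rightarrow> real"
  auto_headway :: "nat \<Rightarrow> real"
  human_headway :: "nat \<Rightarrow> real"

definition roads :: "road_network \<Rightarrow> nat set" where
  "roads G = {1..num_roads G}"

datatype road_state = Free_Flow | Congested

record routing =
  human_flow :: "nat \<Rightarrow> real"
  auto_flow :: "nat \<Rightarrow> real"
  road_state :: "nat \<Rightarrow> road_state"

definition crit_dens :: "road_network \<Rightarrow> nat \<Rightarrow> real \<Rightarrow> real \<Rightarrow> real" where
  "crit_dens G i x y =
     inverse (y / (x + y) * auto_headway G i + x / (x + y) * human_headway G i + veh_len G)"

definition max_flow :: "road_network \<Rightarrow> nat \<Rightarrow> real \<Rightarrow> real \<Rightarrow> real" where
  "max_flow G i x y = ff_speed G i * crit_dens G i x y"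

definition ff_latency :: "road_network \<Rightarrow> nat \<Rightarrow> real" where
  "ff_latency G i = road_len G i / ff_speed G i"

fun latency :: "road_network \<Rightarrow> nat \<Rightarrow> real \<Rightarrow> real \<Rightarrow> road_state \<Rightarrow> real" where
  "latency G i x y Free_Flow = ff_latency G i"
| "latency G i x y Congested =
     road_len G i * (max_dens G i / (x + y)
       + (crit_dens G i x y - max_dens G i) / max_flow G i x y)"

text \<open>
  Headways are distances, hence positive. The bound on the critical density is
  imposed only for nonzero flows, where \<^const>\<open>crit_dens\<close> is meaningful.
\<close>

definition parallel_network :: "road_network \<Rightarrow> bool" where
  "parallel_network G \<longleftrightarrow>
     num_roads G \<ge> 1 \<and> veh_len G > 0 \<and>
     (\<forall>i\<in>roads G.
        road_len G i > 0 \<and> ff_speed G i > 0 \<and>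
        0 < auto_headway G i \<and> auto_headway G i \<le> human_headway G i \<and>
        (\<forall>x y. x \<ge> 0 \<longrightarrow> y \<ge> 0 \<longrightarrow> x + y > 0 \<longrightarrow> crit_dens G i x y < max_dens G i)) \<and>
     (\<forall>i\<in>roads G. \<forall>j\<in>roads G. i < j \<longrightarrow> ff_latency G i < ff_latency G j)"

definition flow_on :: "routing \<Rightarrow> nat \<Rightarrow> real" where
  "flow_on r i = human_flow r i + auto_flow r i"

definition latency_on :: "road_network \<Rightarrow> routing \<Rightarrow> nat \<Rightarrow> real" where
  "latency_on G r i = latency G i (human_flow r i) (auto_flow r i) (road_state r i)"

definition total_latency :: "road_network \<Rightarrow> routing \<Rightarrow> real" where
  "total_latency G r = (\<Sum>i\<in>roads G. flow_on r i * latency_on G r i)"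

text \<open>
  A road with zero flow is in free-flow, so the division by zero in the congested
  latency is never used by a feasible routing.
\<close>

definition feasible_routing :: "road_network \<Rightarrow> real \<Rightarrow> real \<Rightarrow> routing \<Rightarrow> bool" where
  "feasible_routing G xbar ybar r \<longleftrightarrow>
     (\<forall>i\<in>roads G. human_flow r i \<ge> 0 \<and> auto_flow r i \<ge> 0) \<and>
     (\<Sum>i\<in>roads G. human_flow r i) = xbar \<and>
     (\<Sum>i\<in>roads G. auto_flow r i) = ybar \<and>
     (\<forall>i\<in>roads G. flow_on r i > 0 \<longrightarrow>
        flow_on r i \<le> max_flow G i (human_flow r i) (auto_flow r i)) \<and>
     (\<forall>i\<in>roads G. flow_on r i = 0 \<longrightarrow> road_state r i = Free_Flow)"

definition nash_eq :: "road_network \<Rightarrow> real \<Rightarrow> real \<Rightarrow> routing \<Rightarrow> bool" where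
  "nash_eq G xbar ybar r \<longleftrightarrow>
     feasible_routing G xbar ybar r \<and>
     (\<forall>i\<in>roads G. flow_on r i > 0 \<longrightarrow> (\<forall>j\<in>roads G. latency_on G r i \<le> latency_on G r j))"

definition best_nash_eq :: "road_network \<Rightarrow> real \<Rightarrow> real \<Rightarrow> routing \<Rightarrow> bool" where
  "best_nash_eq G xbar ybar r \<longleftrightarrow>
     nash_eq G xbar ybar r \<and>
     (\<forall>r'. nash_eq G xbar ybar r' \<longrightarrow> total_latency G r \<le> total_latency G r')"

text \<open>
  The equilibrium latency \<open>l0\<close> is required to be positive, as every road latency is. This
  only matters without human-driven traffic: there \<open>l0 = 0\<close> would turn \<open>l / l0\<close> into \<open>0\<close>
  and make the last condition vacuous.
\<close>

definition altruistic_nash_eq ::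
    "road_network \<Rightarrow> real \<Rightarrow> real \<Rightarrow> (real \<Rightarrow> real) \<Rightarrow> real \<Rightarrow> routing \<Rightarrow> bool" where
  "altruistic_nash_eq G xbar ybar \<phi> l0 r \<longleftrightarrow>
     feasible_routing G xbar ybar r \<and> l0 > 0 \<and>
     (\<forall>i\<in>roads G. human_flow r i > 0 \<longrightarrow> latency_on G r i = l0) \<and>
     (\<forall>i\<in>roads G. l0 \<le> latency_on G r i) \<and>
     (\<forall>l\<ge>0. \<phi> (l / l0) * ybar \<le> (\<Sum>i | i \<in> roads G \<and> latency_on G r i \<le> l. auto_flow r i))"

definition best_altruistic_nash_eq ::
    "road_network \<Rightarrow> real \<Rightarrow> real \<Rightarrow> (real \<Rightarrow> real) \<Rightarrow> routing \<Rightarrow> bool" where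
  "best_altruistic_nash_eq G xbar ybar \<phi> r \<longleftrightarrow>
     (\<exists>l0. altruistic_nash_eq G xbar ybar \<phi> l0 r) \<and>
     (\<forall>l0' r'. altruistic_nash_eq G xbar ybar \<phi> l0' r' \<longrightarrow>
        total_latency G r \<le> total_latency G r')"

definition uniform_altruism :: "real \<Rightarrow> real \<Rightarrow> real" where
  "uniform_altruism \<kappa>\<^sub>0 \<kappa> = (if \<kappa> \<le> \<kappa>\<^sub>0 then 0 else 1)"

end

theory Submission
  imports Defs
begin

text \<open>
  The example has three roads with free-flow latencies \<open>1 < 1 + \<delta> < A\<close>, and a purely autonomous
  demand that is exactly the joint capacity of the two fast roads.

  Users who tolerate a factor \<open>\<kappa>\<^sub>0 = 1 + \<delta>\<close> can fill both fast roads in free-flow. Since no flow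
  within capacity travels faster than free-flow (\<open>ff_latency_le_latency\<close>), the demand can then be
  served no better, so this routing is a best altruistic equilibrium, of cost \<open>2 + \<delta>\<close>.

  Selfish users cannot do this. A saturated road has its free-flow latency whether it is labelled
  free-flow or congested (\<open>latency_saturated\<close>), so if the two fast roads carried the whole demand,
  the users of the second one would prefer the first. Road 1 must therefore congest down below its
  capacity, and the displaced flow, however small, has to use the slow road. Once
  the slow road is used at equilibrium, every road has latency at least \<open>A\<close>
  (\<open>nash_example_total_ge\<close>). The cost ratio is thus \<open>2 * A / (2 + \<delta>)\<close>, which is unbounded in
  \<open>A\<close> for every fixed \<open>\<delta>\<close>.
\<close>

section \<open>Congested and free-flow latencies\<close>

lemma crit_dens_pos:
  assumes "parallel_network G" "i \<in> roads G" "x \<ge> 0" "y \<ge> 0"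
  shows "crit_dens G i x y > 0"
proof -
  have "y / (x + y) * auto_headway G i \<ge> 0" "x / (x + y) * human_headway G i \<ge> 0"
    using assms by (fastforce simp: parallel_network_def intro!: mult_nonneg_nonneg)+
  moreover have "veh_len G > 0"
    using assms by (simp add: parallel_network_def)
  ultimately show ?thesis
    by (simp add: crit_dens_def add_nonneg_pos)
qed

text \<open>
  The congested branch splits into the free-flow latency and a penalty that measures how far
  the flow has fallen below capacity. The penalty is nonnegative for feasible flows
  and vanishes at saturation.
\<close>

lemma latency_congested_decomp:
  assumes "parallel_network G" "i \<in> roads G" "x \<ge> 0" "y \<ge> 0"
  shows "latency G i x y Congested =
    ff_latency G i + road_len G i * max_dens G i * (1 / (x + y) - 1 / max_flow G i x y)"
proof -
  have "crit_dens G i x y \<noteq> 0" "ff_speed G i \<noteq> 0"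
    using crit_dens_pos[OF assms] assms by (auto simp: parallel_network_def)
  then have "crit_dens G i x y / max_flow G i x y = 1 / ff_speed G i"
    by (simp add: max_flow_def)
  then show ?thesis
    by (simp add: ff_latency_def diff_divide_distrib algebra_simps)
qed

lemma ff_latency_le_latency:
  assumes G: "parallel_network G" "i \<in> roads G"
    and xy: "x \<ge> 0" "y \<ge> 0" "x + y > 0" "x + y \<le> max_flow G i x y"
  shows "ff_latency G i \<le> latency G i x y s"
proof (cases s)
  case Congested
  have "road_len G i > 0"
    using G by (simp add: parallel_network_def)
  moreover have "max_dens G i > 0"
    using G xy crit_dens_pos[OF G xy(1,2)] by (fastforce simp: parallel_network_def)
  moreover have "1 / max_flow G i x y \<le> 1 / (x + y)"
    using xy by (intro divide_left_mono) auto
  ultimately show ?thesis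
    using latency_congested_decomp[OF G xy(1,2)] Congested by simp
qed simp

lemma latency_saturated:
  assumes "parallel_network G" "i \<in> roads G" "x \<ge> 0" "y \<ge> 0" "x + y = max_flow G i x y"
  shows "latency G i x y s = ff_latency G i"
  using latency_congested_decomp[OF assms(1-4)] assms(5) by (cases s) auto

lemma feasible_ff_latency_le:
  assumes G: "parallel_network G" "i \<in> roads G" and r: "feasible_routing G xbar ybar r"
  shows "ff_latency G i \<le> latency_on G r i"
proof (cases "flow_on r i = 0")
  case True
  then show ?thesis
    using G r by (simp add: feasible_routing_def latency_on_def)
next
  case False
  have nn: "human_flow r i \<ge> 0" "auto_flow r i \<ge> 0"
    using G r by (auto simp: feasible_routing_def)
  moreover have "flow_on r i > 0"
    using nn False by (simp add: flow_on_def)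
  ultimately show ?thesis
    using G r unfolding latency_on_def
    by (intro ff_latency_le_latency) (auto simp: feasible_routing_def flow_on_def)
qed

section \<open>The three-road example\<close>

text \<open>
  Equal headways make the critical density \<open>1 / 2\<close> for every mix of vehicles, so that capacities
  are half the free-flow speeds, namely 1, 1 and 2. The slow road could carry the whole demand
  by itself, which ensures that a Nash equilibrium exists.
\<close>

definition example_network :: "real \<Rightarrow> real \<Rightarrow> road_network" where
  "example_network \<delta> A =
     \<lparr>num_roads = 3, veh_len = 1,
      road_len = (\<lambda>i. if i = 1 then 2 else if i = 3 then 4 * A else 2 * (1 + \<delta>)),
      ff_speed = (\<lambda>i. if i = 3 then 4 else 2),
      max_dens = (\<lambda>_. 1), auto_headway = (\<lambda>_. 1), human_headway = (\<lambda>_. 1)\<rparr>"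

lemma roads_example: "roads (example_network \<delta> A) = {1, 2, 3}"
  by (auto simp: roads_def example_network_def)

lemma crit_dens_example: "x + y > 0 \<Longrightarrow> crit_dens (example_network \<delta> A) i x y = 1 / 2"
  by (simp add: crit_dens_def example_network_def inverse_eq_divide flip: add_divide_distrib)
     (simp add: add.commute)

lemma max_flow_example:
  "x + y > 0 \<Longrightarrow> max_flow (example_network \<delta> A) i x y = (if i = 3 then 2 else 1)"
  by (simp add: max_flow_def crit_dens_example) (simp add: example_network_def)

lemma ff_latency_example:
  "ff_latency (example_network \<delta> A) i =
     (if i = 1 then 1 else if i = 3 then A else 1 + \<delta>)"
  by (simp add: ff_latency_def example_network_def)

lemma parallel_network_example:
  assumes "0 < \<delta>" "1 + \<delta> < A"
  shows "parallel_network (example_network \<delta> A)"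
proof -
  have "ff_latency (example_network \<delta> A) i < ff_latency (example_network \<delta> A) j"
    if "i \<in> {1,2,3}" "j \<in> {1,2,3}" "i < j" for i j :: nat
    using that assms by (auto simp: ff_latency_example)
  then show ?thesis
    using assms unfolding parallel_network_def roads_example
    by (simp add: crit_dens_example) (simp add: example_network_def)
qed

lemma feasible_exampleD:
  assumes "feasible_routing (example_network \<delta> A) 0 2 r"
  shows "flow_on r 1 \<le> 1" "flow_on r 2 \<le> 1"
    "flow_on r 1 \<ge> 0" "flow_on r 2 \<ge> 0" "flow_on r 3 \<ge> 0"
    "flow_on r 1 + flow_on r 2 + flow_on r 3 = 2"
proof -
  note r = assms[unfolded feasible_routing_def roads_example flow_on_def]
  have "flow_on r i \<le> 1" if "i \<in> {1, 2}" for i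
    using r that max_flow_example[of "human_flow r i" "auto_flow r i" \<delta> A i]
    by (cases "flow_on r i > 0") (auto simp: flow_on_def)
  then show "flow_on r 1 \<le> 1" "flow_on r 2 \<le> 1" by auto
  show "flow_on r 1 \<ge> 0" "flow_on r 2 \<ge> 0" "flow_on r 3 \<ge> 0"
    "flow_on r 1 + flow_on r 2 + flow_on r 3 = 2"
    using r by (auto simp: flow_on_def)
qed

lemma total_latency_example:
  "total_latency (example_network \<delta> A) r =
     flow_on r 1 * latency_on (example_network \<delta> A) r 1
   + flow_on r 2 * latency_on (example_network \<delta> A) r 2
   + flow_on r 3 * latency_on (example_network \<delta> A) r 3"
  by (simp add: total_latency_def roads_example)

section \<open>The altruistic equilibrium\<close>

definition altruistic_routing :: routing where
  "altruistic_routing =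
     \<lparr>human_flow = (\<lambda>_. 0), auto_flow = (\<lambda>i. if i = 3 then 0 else 1),
      road_state = (\<lambda>_. Free_Flow)\<rparr>"

lemma flows_altruistic:
  "human_flow altruistic_routing i = 0"
  "auto_flow altruistic_routing i = (if i = 3 then 0 else 1)"
  "road_state altruistic_routing i = Free_Flow"
  by (simp_all add: altruistic_routing_def)

lemma latency_on_altruistic:
  "latency_on G altruistic_routing i = ff_latency G i"
  by (simp add: latency_on_def flows_altruistic)

lemma feasible_altruistic:
  "feasible_routing (example_network \<delta> A) 0 2 altruistic_routing"
  by (simp add: feasible_routing_def roads_example flow_on_def flows_altruistic
      max_flow_example)

lemma total_latency_altruistic:
  "total_latency (example_network \<delta> A) altruistic_routing = 2 + \<delta>"
  by (simp add: total_latency_example latency_on_altruistic ff_latency_example flow_on_def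
      flows_altruistic)

text \<open>
  Filling the roads greedily in the order of their free-flow latencies is optimal among all
  routings, equilibria or not.
\<close>

lemma feasible_example_total_ge:
  assumes d: "0 < \<delta>" "1 + \<delta> < A" and r: "feasible_routing (example_network \<delta> A) 0 2 r"
  shows "2 + \<delta> \<le> total_latency (example_network \<delta> A) r"
proof -
  let ?f = "flow_on r" and ?l = "latency_on (example_network \<delta> A) r"
  note f = feasible_exampleD[OF r]
  have l: "ff_latency (example_network \<delta> A) i \<le> ?l i" if "i \<in> {1, 2, 3}" for i
    using feasible_ff_latency_le[OF parallel_network_example[OF d] _ r] that
    by (simp add: roads_example)
  have f2: "?f 2 = 2 - ?f 1 - ?f 3"
    using f(6) by simp
  have "2 + \<delta> \<le> 2 + \<delta> + \<delta> * (1 - ?f 1) + (A - 1 - \<delta>) * ?f 3"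
    using f d by simp
  also have "\<dots> = ?f 1 + (2 - ?f 1 - ?f 3) * (1 + \<delta>) + ?f 3 * A"
    by (simp add: algebra_simps)
  also have "\<dots> = ?f 1 * 1 + ?f 2 * (1 + \<delta>) + ?f 3 * A"
    using f2 by simp
  also have "\<dots> \<le> ?f 1 * ?l 1 + ?f 2 * ?l 2 + ?f 3 * ?l 3"
    using f l[of 1] l[of 2] l[of 3]
    by (intro add_mono mult_left_mono) (auto simp: ff_latency_example)
  finally show ?thesis by (simp add: total_latency_example)
qed

lemma best_altruistic_example:
  assumes d: "0 < \<delta>" "1 + \<delta> < A"
  shows "best_altruistic_nash_eq (example_network \<delta> A) 0 2 (uniform_altruism (1 + \<delta>))
           altruistic_routing"
proof -
  let ?G = "example_network \<delta> A"
  have tolerated: "uniform_altruism (1 + \<delta>) (l / 1) * 2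
      \<le> (\<Sum>i | i \<in> roads ?G \<and> latency_on ?G altruistic_routing i \<le> l.
            auto_flow altruistic_routing i)" for l
  proof (cases "l \<le> 1 + \<delta>")
    case True
    then show ?thesis
      by (auto simp: uniform_altruism_def flows_altruistic intro!: sum_nonneg)
  next
    case False
    have "(2::real) = (\<Sum>i\<in>{1, 2}. auto_flow altruistic_routing i)"
      by (simp add: flows_altruistic)
    also have "\<dots> \<le> (\<Sum>i | i \<in> roads ?G \<and> latency_on ?G altruistic_routing i \<le> l.
            auto_flow altruistic_routing i)"
      using False d
      by (intro sum_mono2)
         (auto simp: roads_example latency_on_altruistic ff_latency_example
            flows_altruistic)
    finally show ?thesis
      using False by (simp add: uniform_altruism_def)
  qed
  have "altruistic_nash_eq ?G 0 2 (uniform_altruism (1 + \<delta>)) 1 altruistic_routing"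
    unfolding altruistic_nash_eq_def
  proof (intro conjI allI impI)
    show "\<forall>i\<in>roads ?G. human_flow altruistic_routing i > 0 \<longrightarrow>
        latency_on ?G altruistic_routing i = 1"
      by (simp add: flows_altruistic)
    show "\<forall>i\<in>roads ?G. 1 \<le> latency_on ?G altruistic_routing i"
      using d by (simp add: roads_example latency_on_altruistic ff_latency_example)
  qed (use feasible_altruistic tolerated in auto)
  moreover have "total_latency ?G altruistic_routing \<le> total_latency ?G r'"
    if "altruistic_nash_eq ?G 0 2 \<phi> l0 r'" for \<phi> l0 r'
    using that feasible_example_total_ge[OF d]
    by (simp add: total_latency_altruistic altruistic_nash_eq_def)
  ultimately show ?thesis
    unfolding best_altruistic_nash_eq_def by blast
qed

section \<open>The selfish equilibrium\<close>

text \<open>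
  Without the slow road, both fast roads would be saturated and hence have their distinct free-flow
  latencies, against equilibrium. So the slow road is used, and its latency is a lower bound
  for all the others.
\<close>

lemma nash_example_total_ge:
  assumes d: "0 < \<delta>" "1 + \<delta> < A" and nash: "nash_eq (example_network \<delta> A) 0 2 r"
  shows "2 * A \<le> total_latency (example_network \<delta> A) r"
proof -
  let ?G = "example_network \<delta> A"
  let ?f = "flow_on r" and ?l = "latency_on ?G r"
  note G = parallel_network_example[OF d]
  have r: "feasible_routing ?G 0 2 r"
    using nash by (simp add: nash_eq_def)
  note f = feasible_exampleD[OF r]
  have le: "?l i \<le> ?l j" if "?f i > 0" "i \<in> {1, 2, 3}" "j \<in> {1, 2, 3}" for i j
    using nash that unfolding nash_eq_def roads_example by blast
  have "?f 3 > 0"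
  proof (rule ccontr)
    assume "\<not> ?f 3 > 0"
    then have full: "?f 1 = 1" "?f 2 = 1" using f by auto
    have "?l i = ff_latency ?G i" if "i \<in> {1, 2}" for i
      unfolding latency_on_def using r full that
      by (intro latency_saturated[OF G])
         (auto simp: roads_example feasible_routing_def flow_on_def max_flow_example)
    then have "?l 2 > ?l 1"
      using d by (simp add: ff_latency_example)
    then show False
      using le[of 2 1] full by simp
  qed
  have "A \<le> ?l 3"
    using feasible_ff_latency_le[OF G _ r, of 3] by (simp add: roads_example ff_latency_example)
  then have l: "A \<le> ?l j" if "j \<in> {1, 2, 3}" for j
    using le[of 3 j] \<open>?f 3 > 0\<close> that by simp
  have "2 * A = ?f 1 * A + ?f 2 * A + ?f 3 * A"
    using f(6) by (simp flip: distrib_right)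
  also have "\<dots> \<le> ?f 1 * ?l 1 + ?f 2 * ?l 2 + ?f 3 * ?l 3"
    using f l by (intro add_mono mult_left_mono) auto
  finally show ?thesis
    by (simp add: total_latency_example)
qed

text \<open>
  On the fast road \<open>i\<close> of free-flow latency \<open>a\<close>, a congested flow \<open>f\<close> has latency
  \<open>a * (2 / f - 1)\<close>; solving for latency \<open>A\<close> gives \<open>f = 2 * a / (A + a)\<close>.
\<close>

definition selfish_routing :: "real \<Rightarrow> real \<Rightarrow> routing" where
  "selfish_routing \<delta> A =
     \<lparr>human_flow = (\<lambda>_. 0),
      auto_flow = (\<lambda>i. if i = 1 then 2 / (A + 1) else if i = 2 then 2 * (1 + \<delta>) / (A + (1 + \<delta>))
                       else 2 - 2 / (A + 1) - 2 * (1 + \<delta>) / (A + (1 + \<delta>))),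
      road_state = (\<lambda>i. if i = 3 then Free_Flow else Congested)\<rparr>"

lemma best_nash_example:
  assumes d: "0 < \<delta>" "1 + \<delta> < A"
  shows "best_nash_eq (example_network \<delta> A) 0 2 (selfish_routing \<delta> A)"
    and "total_latency (example_network \<delta> A) (selfish_routing \<delta> A) = 2 * A"
proof -
  let ?G = "example_network \<delta> A" and ?r = "selfish_routing \<delta> A"
  define p where "p = 2 / (A + 1)"
  define q where "q = 2 * (1 + \<delta>) / (A + (1 + \<delta>))"
  have pq: "0 < p" "p < 1" "0 < q" "q < 1"
    using d by (auto simp: p_def q_def field_simps)
  have flows: "human_flow ?r i = 0"
    "auto_flow ?r i = (if i = 1 then p else if i = 2 then q else 2 - p - q)"
    "road_state ?r i = (if i = 3 then Free_Flow else Congested)"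
    for i
    by (simp_all add: selfish_routing_def p_def q_def)
  have feas: "feasible_routing ?G 0 2 ?r"
    using pq by (simp add: feasible_routing_def roads_example flow_on_def flows max_flow_example)
  have "latency_on ?G ?r 1 = 2 / p - 1"
    using pq by (simp add: latency_on_def flows crit_dens_example max_flow_example)
      (simp add: example_network_def)
  then have l1: "latency_on ?G ?r 1 = A"
    using d by (simp add: p_def add_divide_distrib)
  have "latency_on ?G ?r 2 = (1 + \<delta>) * (2 / q - 1)"
    using pq by (simp add: latency_on_def flows crit_dens_example max_flow_example)
      (simp add: example_network_def field_simps)
  moreover have "2 / q - 1 = A / (1 + \<delta>)"
    using d by (simp add: q_def field_simps)
  ultimately have l2: "latency_on ?G ?r 2 = A"
    using d by simp
  have l3: "latency_on ?G ?r 3 = A"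
    by (simp add: latency_on_def flows ff_latency_example)
  note l = l1 l2 l3
  have nash: "nash_eq ?G 0 2 ?r"
    using feas l by (simp add: nash_eq_def roads_example)
  have "total_latency ?G ?r = (flow_on ?r 1 + flow_on ?r 2 + flow_on ?r 3) * A"
    by (simp only: total_latency_example l distrib_right)
  then show total: "total_latency ?G ?r = 2 * A"
    using feasible_exampleD(6)[OF feas] by simp
  show "best_nash_eq ?G 0 2 ?r"
    using nash nash_example_total_ge[OF d] by (simp add: best_nash_eq_def total)
qed

section \<open>Unbounded gain from arbitrarily low altruism\<close>

theorem mainTheorem5:
  fixes M \<epsilon> :: real
  assumes "M > 0" and "\<epsilon> > 0"
  shows "\<exists>(G :: road_network) (xbar :: real) (ybar :: real) (\<kappa>\<^sub>0 :: real)
            (r_BNE :: routing) (r_BANE :: routing).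
           parallel_network G \<and> xbar \<ge> 0 \<and> ybar \<ge> 0 \<and> 1 < \<kappa>\<^sub>0 \<and> \<kappa>\<^sub>0 < 1 + \<epsilon> \<and>
           best_nash_eq G xbar ybar r_BNE \<and>
           best_altruistic_nash_eq G xbar ybar (uniform_altruism \<kappa>\<^sub>0) r_BANE \<and>
           total_latency G r_BNE / total_latency G r_BANE \<ge> M"
proof -
  define \<delta> where "\<delta> = min 1 (\<epsilon> / 2)"
  (* As 2 + \<delta> is at most 3, this A makes the ratio at least (4 * M + 4) / 3. *)
  define A where "A = 2 * M + 2"
  have d: "0 < \<delta>" "1 + \<delta> < A" and small: "\<delta> \<le> 1" "\<delta> < \<epsilon>"
    using assms by (auto simp: \<delta>_def A_def)
  have "M * (2 + \<delta>) \<le> M * 3"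
    using assms small by (intro mult_left_mono) auto
  also have "\<dots> \<le> 2 * A"
    using assms by (simp add: A_def)
  finally have "M \<le> 2 * A / (2 + \<delta>)"
    using d by (simp add: field_simps)
  then have "total_latency (example_network \<delta> A) (selfish_routing \<delta> A) /
      total_latency (example_network \<delta> A) altruistic_routing \<ge> M"
    by (simp add: best_nash_example(2)[OF d] total_latency_altruistic)
  then show ?thesis
    using parallel_network_example[OF d] best_nash_example(1)[OF d]
      best_altruistic_example[OF d] d small
    by (intro exI[of _ "example_network \<delta> A"] exI[of _ 0] exI[of _ 2] exI[of _ "1 + \<delta>"]
        exI[of _ "selfish_routing \<delta> A"] exI[of _ altruistic_routing]) auto
qed

end
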